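(* Let $f : \mathbb{R}^n \rightarrow \mathbb{R}$ be locally Lipschitz continuous. Let $(x^j)_j$ be a sequence in $\mathbb{R}^n$ and let $(\varepsilon_j)_j$, $(\delta_j)_j$ be sequences in $\mathbb{R}^{\geq 0}$ such that $x^j \rightarrow x^* \in \mathbb{R}^n$, $\varepsilon_j \rightarrow 0$, and $\min(\| \partial_{\varepsilon_j} f(x^j) \|) \leq \delta_j$ for all $j \in \mathbb{N}$. Assume that $x^*$ is a minimum of order $p \in \mathbb{N}$ with constant $\beta > 0$ of $f$, and that $$\liminf_{\xi \in \partial f(x^* + t d'),\, t \searrow 0,\, d' \rightarrow d} \frac{\langle \xi, d' \rangle}{t^{p-1}} \geq \beta \| d \|^p \quad \text{for all } d \in \mathbb{R}^n \setminus \{0\}.$$ (i) If $p = 1$ and $\delta_j \rightarrow \bar{\delta}$ for some $\bar{\delta} < \beta$, then there are $M > 0$ and $N \in \mathbb{N}$ such that $$\| x^j - x^* \| \leq M \varepsilon_j \quad \text{for all } j > N.$$ (ii) If $p \geq 2$, then there are $M > 0$ and $N \in \mathbb{N}$ such that $$\| x^j - x^* \| \leq M \max\left(\varepsilon_j^{\frac{1}{p}}, \delta_j^{\frac{1}{p-1}}\right) \quad \text{for all } j > N.$$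
   Context: $\mathbb{N} = \{1,2,\dots\}$; $\|\cdot\|$ is the Euclidean norm and $\langle\cdot,\cdot\rangle$ the Euclidean inner product on $\mathbb{R}^n$. Clarke subdifferential: for a locally Lipschitz continuous $f : \mathbb{R}^n \to \mathbb{R}$, let $\Omega$ be the (null) set of points where $f$ is not differentiable. Then $\partial f(x)$ is the convex hull of the set of all $\xi \in \mathbb{R}^n$ for which there is a sequence $(y^k)_k$ in $\mathbb{R}^n \setminus \Omega$ with $y^k \to x$ and $\nabla f(y^k) \to \xi$. Goldstein $\varepsilon$-subdifferential: for $\varepsilon \geq 0$, $\partial_\varepsilon f(x) := \operatorname{conv}\big(\bigcup_{y \in \bar{B}_\varepsilon(x)} \partial f(y)\big)$, where $\bar{B}_\varepsilon(x) = \{ y \in \mathbb{R}^n : \|y - x\| \leq \varepsilon\}$. This set is compact. The condition $\min(\|\partial_\varepsilon f(x)\|) \leq \delta$ means that there is some $\xi \in \partial_\varepsilon f(x)$ with $\|\xi\| \leq \delta$. Minimum of order $p$: $x^*$ is a minimum of order $p \in \mathbb{N}$ with constant $\beta > 0$ of $f$ if there is an open set $U \subseteq \mathbb{R}^n$ with $x^* \in U$ and $f(x) \geq f(x^* ) + \beta \|x - x^*\|^p$ for all $x \in U$. The limit inferior in the claim is an element of $\mathbb{R} \cup \{-\infty,\infty\}$ and is the infimum of $\liminf_{k\to\infty} \langle \xi^k, d^k\rangle / t_k^{p-1}$ over all sequences with $t_k > 0$, $t_k \to 0$, $d^k \to d$ and $\xi^k \in \partial f(x^* + t_k d^k)$.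 *)

theory Defs
  imports "HOL-Analysis.Analysis"
begin

definition locally_lipschitz :: "(real ^ 'n \<Rightarrow> real) \<Rightarrow> bool" where
  "locally_lipschitz f \<longleftrightarrow> (\<forall>x. \<exists>u>0. \<exists>L. L-lipschitz_on (cball x u) f)"

text \<open>The library's two-argument notion \<^const>\<open>local_lipschitz\<close> carries an additional time
  parameter; the notion above is the time-independent case.\<close>

lemma locally_lipschitz_iff_local_lipschitz:
  "locally_lipschitz f \<longleftrightarrow> local_lipschitz (UNIV :: real set) UNIV (\<lambda>_. f)"
proof -
  have "cball t u \<noteq> {}" if "u > 0" for t u :: real
    using that by simp
  then have "(\<forall>s\<in>cball t u. L-lipschitz_on (cball x u) f) \<longleftrightarrow> L-lipschitz_on (cball x u) f"
    if "u > 0" for t u L :: real and x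
    using that by blast
  then show ?thesis
    unfolding locally_lipschitz_def local_lipschitz_def Int_UNIV_right by blast
qed

text \<open>The statement \<open>GDERIV f (y k) :> g k\<close> says both that \<open>f\<close> is differentiable at \<open>y k\<close> and
  that its gradient there is \<open>g k\<close>.\<close>

definition clarke_subdiff :: "(real ^ 'n \<Rightarrow> real) \<Rightarrow> real ^ 'n \<Rightarrow> (real ^ 'n) set" where
  "clarke_subdiff f x = convex hull
     {\<xi>. \<exists>y g. (\<forall>k::nat. GDERIV f (y k) :> g k) \<and> y \<longlonglongrightarrow> x \<and> g \<longlonglongrightarrow> \<xi>}"

definition goldstein_subdiff ::
  "real \<Rightarrow> (real ^ 'n \<Rightarrow> real) \<Rightarrow> real ^ 'n \<Rightarrow> (real ^ 'n) set" where
  "goldstein_subdiff \<epsilon> f x = convex hull (\<Union>y\<in>cball x \<epsilon>. clarke_subdiff f y)"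

definition minimum_of_order :: "nat \<Rightarrow> real \<Rightarrow> (real ^ 'n \<Rightarrow> real) \<Rightarrow> real ^ 'n \<Rightarrow> bool" where
  "minimum_of_order p \<beta> f xs \<longleftrightarrow>
     (\<exists>U. open U \<and> xs \<in> U \<and> (\<forall>x\<in>U. f x \<ge> f xs + \<beta> * norm (x - xs) ^ p))"

text \<open>The lower limit of \<open>\<langle>\<xi>, d'\<rangle> / t ^ (p - 1)\<close> as \<open>t\<close> decreases to \<open>0\<close> and \<open>d' \<rightarrow> d\<close>, with \<open>\<xi>\<close>
  ranging over the Clarke subdifferential at \<open>xs + t d'\<close>. It is only meaningful for \<open>p \<ge> 1\<close>,
  since the exponent is a natural number.\<close>

definition subdiff_liminf ::
  "nat \<Rightarrow> (real ^ 'n \<Rightarrow> real) \<Rightarrow> real ^ 'n \<Rightarrow> real ^ 'n \<Rightarrow> ereal" where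
  "subdiff_liminf p f xs d =
     (INF (t, d', \<xi>) \<in> {(t :: nat \<Rightarrow> real, d' :: nat \<Rightarrow> real ^ 'n, \<xi> :: nat \<Rightarrow> real ^ 'n).
          (\<forall>k. t k > 0) \<and> t \<longlonglongrightarrow> 0 \<and> d' \<longlonglongrightarrow> d \<and>
          (\<forall>k. \<xi> k \<in> clarke_subdiff f (xs + t k *\<^sub>R d' k))}.
        liminf (\<lambda>k. ereal ((\<xi> k \<bullet> d' k) / t k ^ (p - 1))))"

end

theory Submission
  imports Defs
begin

text \<open>Near \<open>xs\<close>, the lower limit condition and compactness of the unit sphere yield
  \<open>\<langle>\<xi>, y - xs\<rangle> \<ge> c \<parallel>y - xs\<parallel>\<^sup>p\<close> for every \<open>\<xi> \<in> \<partial>f(y)\<close>, for any fixed \<open>c < \<beta>\<close>. Replacing \<open>y - xs\<close> by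
  \<open>x - xs\<close> with \<open>\<parallel>y - x\<parallel> \<le> \<epsilon>\<close> costs at most \<open>L \<epsilon>\<close>, where \<open>L\<close> is a Lipschitz constant. The
  resulting inequality confines \<open>\<xi>\<close> to a half-space, so it passes to the convex hull, and an element
  of norm at most \<open>\<delta>\<close> of the Goldstein subdifferential gives
  \<open>c (\<parallel>x - xs\<parallel> - \<epsilon>)\<^sup>p \<le> \<delta> \<parallel>x - xs\<parallel> + L \<epsilon>\<close>.\<close>

text \<open>Differentiate along the gradient itself: the derivative of \<open>f\<close> at
  \<open>y\<close> in direction \<open>g\<close> is \<open>g \<bullet> g\<close>, while the
  Lipschitz condition bounds the difference quotients in that direction by
  \<open>L * norm g\<close>. Cancelling one factor \<open>norm g\<close> gives the bound.\<close>

lemma norm_gradient_le_lipschitz: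
  fixes f :: "'a::real_inner \<Rightarrow> real"
  assumes lip: "L-lipschitz_on S f" and "open S" "y \<in> S" and g: "GDERIV f y :> g"
  shows "norm g \<le> L"
proof -
  have "((\<lambda>t. f (y + t *\<^sub>R g)) has_derivative (\<lambda>t. g \<bullet> (t *\<^sub>R g))) (at (0::real))"
  proof (rule has_derivative_compose[of "\<lambda>t. y + t *\<^sub>R g" "\<lambda>t. t *\<^sub>R g" 0 UNIV f "inner g"])
    show "((\<lambda>t. y + t *\<^sub>R g) has_derivative (\<lambda>t. t *\<^sub>R g)) (at 0)"
      by (auto intro!: derivative_eq_intros)
    have "(\<lambda>h. h \<bullet> g) = inner g"
      by (simp add: fun_eq_iff inner_commute)
    then show "(f has_derivative inner g) (at (y + 0 *\<^sub>R g))"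
      using g by (simp add: gderiv_def)
  qed
  then have "((\<lambda>t. f (y + t *\<^sub>R g)) has_field_derivative g \<bullet> g) (at (0::real))"
    by (rule has_derivative_imp_has_field_derivative) simp
  then have lim: "((\<lambda>h. (f (y + h *\<^sub>R g) - f y) / h) \<longlongrightarrow> g \<bullet> g) (at (0::real))"
    by (simp add: DERIV_def)
  have "((\<lambda>h. y + h *\<^sub>R g) \<longlongrightarrow> y + 0 *\<^sub>R g) (at (0::real))"
    by (intro tendsto_intros)
  then have "\<forall>\<^sub>F h in at (0::real). y + h *\<^sub>R g \<in> S"
    using \<open>open S\<close> \<open>y \<in> S\<close> by (intro topological_tendstoD) auto
  then have "\<forall>\<^sub>F h in at (0::real). (f (y + h *\<^sub>R g) - f y) / h \<le> L * norm g"
    using eventually_neq_at_within[of 0]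
  proof eventually_elim
    case (elim h)
    have "\<bar>f (y + h *\<^sub>R g) - f y\<bar> \<le> L * (\<bar>h\<bar> * norm g)"
      using lipschitz_onD[OF lip elim(1) \<open>y \<in> S\<close>] by (simp add: dist_norm)
    then have "\<bar>(f (y + h *\<^sub>R g) - f y) / h\<bar> \<le> L * norm g"
      using elim(2) by (simp add: field_simps)
    then show ?case by linarith
  qed
  then have "g \<bullet> g \<le> L * norm g"
    by (intro tendsto_upperbound[OF lim]) auto
  then have "norm g * norm g \<le> L * norm g"
    by (simp add: dot_square_norm power2_eq_square)
  then show ?thesis
    using lipschitz_on_nonneg[OF lip] by (cases "g = 0") auto
qed

text \<open>Since \<open>S\<close> is open, the gradients in an approximating sequence eventually
  have norm at most \<open>L\<close>. The ball \<open>cball 0 L\<close> is closed and convex, so it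
  keeps their limits and the convex hull of these.\<close>

lemma clarke_subdiff_norm_le:
  assumes lip: "L-lipschitz_on S f" and "open S" "y \<in> S" and "\<xi> \<in> clarke_subdiff f y"
  shows "norm \<xi> \<le> L"
proof -
  have "clarke_subdiff f y \<subseteq> cball 0 L"
    unfolding clarke_subdiff_def
  proof (rule hull_minimal, safe)
    fix \<zeta> z g
    assume grad: "\<forall>k::nat. GDERIV f (z k) :> g k" and "z \<longlonglongrightarrow> y" and "g \<longlonglongrightarrow> \<zeta>"
    have "\<forall>\<^sub>F k in sequentially. z k \<in> S"
      using topological_tendstoD[OF \<open>z \<longlonglongrightarrow> y\<close> \<open>open S\<close> \<open>y \<in> S\<close>] .
    then have "\<forall>\<^sub>F k in sequentially. norm (g k) \<le> L"
      by eventually_elim (use grad norm_gradient_le_lipschitz[OF lip \<open>open S\<close>] in blast)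
    then show "\<zeta> \<in> cball 0 L"
      using tendsto_upperbound[OF tendsto_norm[OF \<open>g \<longlonglongrightarrow> \<zeta>\<close>]] by simp
  qed
  then show ?thesis using assms(4) by auto
qed

lemma subdiff_liminf_imp_growth:
  fixes f :: "real ^ 'n \<Rightarrow> real"
  assumes liminf: "\<And>d. d \<noteq> 0 \<Longrightarrow> subdiff_liminf p f xs d \<ge> ereal (\<beta> * norm d ^ p)"
    and "p \<ge> 1" and "c < \<beta>"
  shows "\<exists>r>0. \<forall>y \<xi>. norm (y - xs) < r \<longrightarrow> \<xi> \<in> clarke_subdiff f y \<longrightarrow>
           c * norm (y - xs) ^ p \<le> \<xi> \<bullet> (y - xs)"
proof (rule ccontr)
  assume contr: "\<not> ?thesis"
  have "\<forall>k. \<exists>y \<xi>. norm (y - xs) < 1 / real (Suc k) \<and> \<xi> \<in> clarke_subdiff f y \<and>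
           \<xi> \<bullet> (y - xs) < c * norm (y - xs) ^ p"
    using contr by (metis not_le of_nat_0_less_iff zero_less_Suc zero_less_divide_1_iff)
  then obtain y \<xi> where y: "\<And>k. norm (y k - xs) < 1 / real (Suc k)"
    and \<xi>: "\<And>k. \<xi> k \<in> clarke_subdiff f (y k)"
    and lt: "\<And>k. \<xi> k \<bullet> (y k - xs) < c * norm (y k - xs) ^ p"
    by metis
  \<comment> \<open>The counterexamples are written in polar coordinates around \<open>xs\<close>,
    so that a convergent subsequence of directions becomes an admissible triple for
    \<open>subdiff_liminf\<close>.\<close>
  define t where "t k = norm (y k - xs)" for k
  define d' where "d' k = (y k - xs) /\<^sub>R t k" for k
  \<comment> \<open>At \<open>xs\<close> both sides of the strict inequality \<open>lt\<close> would
    be 0, because \<open>p \<ge> 1\<close>.\<close>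
  have "y k \<noteq> xs" for k
    using lt[of k] \<open>p \<ge> 1\<close> by (auto simp: power_0_left)
  then have t_pos: "t k > 0" for k
    by (simp add: t_def)
  have "t \<longlonglongrightarrow> 0"
    by (rule Lim_null_comparison[OF _ LIMSEQ_Suc[OF lim_1_over_n]])
      (use y in \<open>simp add: t_def less_imp_le del: of_nat_Suc\<close>)
  have "d' k \<in> sphere 0 1" for k
    using t_pos[of k] by (simp add: d'_def t_def)
  then obtain d \<sigma> where d: "d \<in> sphere 0 1" and "strict_mono \<sigma>" and "(d' \<circ> \<sigma>) \<longlonglongrightarrow> d"
    using compact_sphere[of "0::real^'n" 1] unfolding compact_def by metis
  have y_eq: "xs + t k *\<^sub>R d' k = y k" for k
    using t_pos[of k] by (simp add: d'_def)
  have quot: "(\<xi> k \<bullet> d' k) / t k ^ (p - 1) \<le> c" for k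
  proof -
    have "t k * t k ^ (p - 1) = t k ^ p"
      using \<open>p \<ge> 1\<close> by (cases p) auto
    moreover have "\<xi> k \<bullet> (y k - xs) = t k * (\<xi> k \<bullet> d' k)"
      using t_pos[of k] by (simp add: d'_def)
    ultimately have "t k * (\<xi> k \<bullet> d' k) \<le> t k * (c * t k ^ (p - 1))"
      using lt[of k] by (simp add: t_def algebra_simps)
    then show ?thesis
      using t_pos[of k] by (simp add: divide_le_eq)
  qed
  \<comment> \<open>The limit direction has norm 1, so the assumed lower bound there is just
    \<beta>, whereas all quotients of the subsequence are at most \<open>c\<close>.\<close>
  have "ereal \<beta> \<le> subdiff_liminf p f xs d"
    using liminf[of d] d by (cases "d = 0") auto
  also have "\<dots> \<le> liminf (\<lambda>k. ereal (((\<xi> \<circ> \<sigma>) k \<bullet> (d' \<circ> \<sigma>) k) / (t \<circ> \<sigma>) k ^ (p - 1)))"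
    unfolding subdiff_liminf_def
    by (rule INF_lower2[of "(t \<circ> \<sigma>, d' \<circ> \<sigma>, \<xi> \<circ> \<sigma>)"])
      (use t_pos \<xi> y_eq \<open>(d' \<circ> \<sigma>) \<longlonglongrightarrow> d\<close> LIMSEQ_subseq_LIMSEQ[OF \<open>t \<longlonglongrightarrow> 0\<close> \<open>strict_mono \<sigma>\<close>] in auto)
  also have "\<dots> \<le> liminf (\<lambda>k. ereal c)"
    by (intro Liminf_mono always_eventually) (use quot in simp)
  also have "\<dots> = ereal c"
    by (simp add: Liminf_const)
  finally show False using \<open>c < \<beta>\<close> by simp
qed

lemma goldstein_subdiff_estimate:
  fixes f :: "real ^ 'n \<Rightarrow> real"
  assumes growth: "\<And>y \<xi>. norm (y - xs) < r \<Longrightarrow> \<xi> \<in> clarke_subdiff f y \<Longrightarrow>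
                     c * norm (y - xs) ^ p \<le> \<xi> \<bullet> (y - xs)"
    and bound: "\<And>y \<xi>. norm (y - xs) < r \<Longrightarrow> \<xi> \<in> clarke_subdiff f y \<Longrightarrow> norm \<xi> \<le> L"
    and "c \<ge> 0" and "L \<ge> 0" and near: "norm (x - xs) + \<epsilon> < r"
    and mem: "\<xi> \<in> goldstein_subdiff \<epsilon> f x" and "norm \<xi> \<le> \<delta>"
  shows "c * max 0 (norm (x - xs) - \<epsilon>) ^ p \<le> \<delta> * norm (x - xs) + L * \<epsilon>"
proof -
  \<comment> \<open>This bound does not depend on the point \<open>y\<close> of the ball, so a
    single half-space contains all the subgradients and hence their convex hull. Truncation at 0
    keeps the base nonnegative, as monotonicity of the power requires when \<epsilon> exceeds the
    distance.\<close>
  define b where "b = c * max 0 (norm (x - xs) - \<epsilon>) ^ p - L * \<epsilon>"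
  have "goldstein_subdiff \<epsilon> f x \<subseteq> {\<zeta>. (x - xs) \<bullet> \<zeta> \<ge> b}"
    unfolding goldstein_subdiff_def
  proof (rule hull_minimal, safe)
    fix y \<zeta>
    assume y: "y \<in> cball x \<epsilon>" and \<zeta>: "\<zeta> \<in> clarke_subdiff f y"
    have dist: "norm (x - y) \<le> \<epsilon>"
      using y by (simp add: dist_norm)
    have y_near: "norm (y - xs) < r"
      using norm_triangle_ineq[of "y - x" "x - xs"] dist near by (simp add: norm_minus_commute)
    have "norm (x - xs) - \<epsilon> \<le> norm (y - xs)"
      using norm_triangle_ineq[of "x - y" "y - xs"] dist by simp
    then have "c * max 0 (norm (x - xs) - \<epsilon>) ^ p \<le> c * norm (y - xs) ^ p"
      using \<open>c \<ge> 0\<close> by (intro mult_left_mono power_mono) auto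
    also have "\<dots> \<le> \<zeta> \<bullet> (y - xs)"
      using growth[OF y_near \<zeta>] .
    also have "\<dots> = (x - xs) \<bullet> \<zeta> - \<zeta> \<bullet> (x - y)"
      by (simp add: inner_diff_left inner_diff_right inner_commute)
    also have "\<dots> \<le> (x - xs) \<bullet> \<zeta> + norm \<zeta> * norm (x - y)"
      using Cauchy_Schwarz_ineq2[of \<zeta> "x - y"] by linarith
    also have "norm \<zeta> * norm (x - y) \<le> L * \<epsilon>"
      using bound[OF y_near \<zeta>] dist \<open>L \<ge> 0\<close> by (intro mult_mono) auto
    finally show "b \<le> (x - xs) \<bullet> \<zeta>"
      by (simp add: b_def)
  qed (rule convex_halfspace_ge)
  then have "b \<le> (x - xs) \<bullet> \<xi>"
    using mem by auto
  also have "\<dots> \<le> norm (x - xs) * norm \<xi>"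
    by (rule norm_cauchy_schwarz)
  also have "\<dots> \<le> \<delta> * norm (x - xs)"
    using \<open>norm \<xi> \<le> \<delta>\<close> by (simp add: mult.commute mult_right_mono)
  finally show ?thesis by (simp add: b_def)
qed

lemma le_powr_inverse_if_power_le:
  fixes a b K :: real
  assumes "a ^ n \<le> K * b" and "n > 0" "a \<ge> 0" "b \<ge> 0" "K \<ge> 0"
  shows "a \<le> K powr (1 / n) * b powr (1 / n)"
proof -
  \<comment> \<open>The case \<open>a = 0\<close> is separate because \<open>powr_realpow\<close>
    wants a positive base; there both sides are 0 by the convention that \<open>0 powr\<close>
    anything is 0.\<close>
  have "a = (a ^ n) powr (1 / n)"
    using assms by (cases "a = 0") (auto simp: powr_realpow[symmetric] powr_powr)
  also have "\<dots> \<le> (K * b) powr (1 / n)"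
    using assms by (intro powr_mono2) auto
  finally show ?thesis using assms by (simp add: powr_mult)
qed

text \<open>Either \<open>D\<close> is comparable to \<epsilon>, or one of the two terms on the
  right of \<open>est\<close> dominates. The summands 2, \<open>?A\<close> and \<open>?B\<close> of
  the constant serve these cases in turn. In \<open>K\<close>, the factor \<open>2 ^ p\<close> pays
  for replacing \<open>D - \<epsilon>\<close> by \<open>D\<close>, and the other 2 for replacing the
  sum of two terms by twice the larger.\<close>

lemma order_estimate:
  fixes D \<epsilon> \<delta> c L :: real
  assumes est: "c * max 0 (D - \<epsilon>) ^ p \<le> \<delta> * D + L * \<epsilon>"
    and "p \<ge> 2" "c > 0" "L \<ge> 0" "0 \<le> \<epsilon>" "\<epsilon> \<le> 1" "\<delta> \<ge> 0" "D \<ge> 0"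
  defines "K \<equiv> 2 * 2 ^ p / c"
  shows "D \<le> (2 + K powr (1 / real (p - 1)) + (K * L) powr (1 / p)) *
           max (\<epsilon> powr (1 / p)) (\<delta> powr (1 / real (p - 1)))"
    (is "_ \<le> (2 + ?A + ?B) * ?m")
proof -
  have "K \<ge> 0" using \<open>c > 0\<close> by (simp add: K_def)
  have m: "?m \<ge> 0" by (simp add: le_max_iff_disj)
  \<comment> \<open>Common end of the three cases: \<open>u\<close> is one summand of the constant
    and \<open>v\<close> one argument of the maximum.\<close>
  have weaken: "D \<le> (2 + ?A + ?B) * ?m" if "D \<le> u * v" "u \<le> 2 + ?A + ?B" "v \<le> ?m" "0 \<le> v" for u v
    using mult_mono[OF that(2,3)] that by (smt (verit) powr_ge_zero)
  have half: "c * D ^ p \<le> 2 ^ p * (\<delta> * D + L * \<epsilon>)" if "D > 2 * \<epsilon>"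
  proof -
    have "D ^ p \<le> (2 * max 0 (D - \<epsilon>)) ^ p"
      using that \<open>D \<ge> 0\<close> by (intro power_mono) auto
    then have "c * D ^ p \<le> 2 ^ p * (c * max 0 (D - \<epsilon>) ^ p)"
      using \<open>c > 0\<close> by (simp add: power_mult_distrib mult.left_commute)
    also have "\<dots> \<le> 2 ^ p * (\<delta> * D + L * \<epsilon>)"
      using est by simp
    finally show ?thesis .
  qed
  have split: "D ^ p \<le> K * w" if "D > 2 * \<epsilon>" "\<delta> * D \<le> w" "L * \<epsilon> \<le> w" for w
  proof -
    have "2 ^ p * (\<delta> * D + L * \<epsilon>) \<le> 2 ^ p * (2 * w)"
      using that by simp
    with half[OF that(1)] show ?thesis
      using \<open>c > 0\<close> by (simp add: K_def field_simps)
  qed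
  consider "D \<le> 2 * \<epsilon>" | "D > 2 * \<epsilon>" "\<delta> * D \<ge> L * \<epsilon>" | "D > 2 * \<epsilon>" "\<delta> * D \<le> L * \<epsilon>"
    by linarith
  then show ?thesis
  proof cases
    case 1
    \<comment> \<open>Here \<open>\<epsilon> \<le> 1\<close> matters: lowering the exponent then
      increases the power.\<close>
    have "\<epsilon> \<le> \<epsilon> powr (1 / p)"
      using powr_mono'[of "1 / p" 1 \<epsilon>] \<open>p \<ge> 2\<close> \<open>0 \<le> \<epsilon>\<close> \<open>\<epsilon> \<le> 1\<close> by simp
    then show ?thesis
      using 1 by (intro weaken[of 2 "\<epsilon> powr (1 / p)"]) auto
  next
    case 2
    have "D ^ p \<le> K * \<delta> * D"
      using split[of "\<delta> * D"] 2 by (simp add: mult.assoc)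
    moreover have "D ^ p = D ^ (p - 1) * D"
      using \<open>p \<ge> 2\<close> by (cases p) auto
    \<comment> \<open>Positivity allows one factor \<open>D\<close> to be cancelled, which is where
      the exponent \<open>p - 1\<close> for \<delta> comes from.\<close>
    moreover have "D > 0" using 2 \<open>0 \<le> \<epsilon>\<close> by linarith
    ultimately have "D ^ (p - 1) \<le> K * \<delta>" by simp
    then have "D \<le> ?A * \<delta> powr (1 / real (p - 1))"
      using le_powr_inverse_if_power_le[of D "p - 1" K \<delta>] \<open>p \<ge> 2\<close> \<open>D > 0\<close> \<open>\<delta> \<ge> 0\<close> \<open>K \<ge> 0\<close> by simp
    then show ?thesis
      by (intro weaken[of ?A "\<delta> powr (1 / real (p - 1))"]) auto
  next
    case 3
    have "D ^ p \<le> (K * L) * \<epsilon>"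
      using split[of "L * \<epsilon>"] 3 by (simp add: mult.assoc)
    then have "D \<le> ?B * \<epsilon> powr (1 / p)"
      using \<open>p \<ge> 2\<close> \<open>D \<ge> 0\<close> \<open>0 \<le> \<epsilon>\<close> \<open>K \<ge> 0\<close> \<open>L \<ge> 0\<close> by (intro le_powr_inverse_if_power_le) auto
    then show ?thesis
      by (intro weaken[of ?B "\<epsilon> powr (1 / p)"]) auto
  qed
qed

theorem theorem1:
  fixes f :: "real ^ 'n \<Rightarrow> real"
    and x :: "nat \<Rightarrow> real ^ 'n" and xs :: "real ^ 'n"
    and \<epsilon> \<delta> :: "nat \<Rightarrow> real"
    and p :: nat and \<beta> :: real
  assumes "locally_lipschitz f"
    and "\<forall>j\<ge>1. \<epsilon> j \<ge> 0" and "\<forall>j\<ge>1. \<delta> j \<ge> 0"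
    and "x \<longlonglongrightarrow> xs" and "\<epsilon> \<longlonglongrightarrow> 0"
    and "\<forall>j\<ge>1. \<exists>\<xi>\<in>goldstein_subdiff (\<epsilon> j) f (x j). norm \<xi> \<le> \<delta> j"
    and "p \<ge> 1" and "\<beta> > 0"
    and "minimum_of_order p \<beta> f xs"
    and "\<forall>d. d \<noteq> 0 \<longrightarrow> subdiff_liminf p f xs d \<ge> ereal (\<beta> * norm d ^ p)"
  shows "(p = 1 \<and> (\<exists>\<delta>'<\<beta>. \<delta> \<longlonglongrightarrow> \<delta>') \<longrightarrow>
            (\<exists>M>0. \<exists>N\<ge>1. \<forall>j>N. norm (x j - xs) \<le> M * \<epsilon> j)) \<and>
         (p \<ge> 2 \<longrightarrow>
            (\<exists>M>0. \<exists>N\<ge>1. \<forall>j>N.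
               norm (x j - xs) \<le> M * max (\<epsilon> j powr (1 / real p)) (\<delta> j powr (1 / real (p - 1)))))"
proof -
  obtain u L where "u > 0" and lip: "L-lipschitz_on (cball xs u) f"
    using assms(1) unfolding locally_lipschitz_def by blast
  have "L \<ge> 0" by (rule lipschitz_on_nonneg[OF lip])
  have bound: "norm \<xi> \<le> L" if "norm (y - xs) < u" "\<xi> \<in> clarke_subdiff f y" for y \<xi>
    by (rule clarke_subdiff_norm_le[OF lipschitz_on_subset[OF lip ball_subset_cball]])
      (use that in \<open>auto simp: dist_norm norm_minus_commute\<close>)
  have dist_lim: "(\<lambda>j. norm (x j - xs)) \<longlonglongrightarrow> 0"
    using tendsto_norm_zero[OF LIM_zero[OF assms(4)]] .
  have estimate: "\<forall>\<^sub>F j in sequentially.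
      c * max 0 (norm (x j - xs) - \<epsilon> j) ^ p \<le> \<delta> j * norm (x j - xs) + L * \<epsilon> j"
    if c: "0 < c" "c < \<beta>" for c
  proof -
    obtain r where "r > 0" and growth: "\<And>y \<xi>. norm (y - xs) < r \<Longrightarrow> \<xi> \<in> clarke_subdiff f y \<Longrightarrow>
        c * norm (y - xs) ^ p \<le> \<xi> \<bullet> (y - xs)"
      using subdiff_liminf_imp_growth[OF _ assms(7) c(2)] assms(10) by metis
    have "(\<lambda>j. norm (x j - xs) + \<epsilon> j) \<longlonglongrightarrow> 0"
      using tendsto_add[OF dist_lim assms(5)] by simp
    \<comment> \<open>Within radius \<open>r\<close> the growth inequality holds, and within
      \<open>u\<close> the norm bound on subgradients.\<close>
    then have "\<forall>\<^sub>F j in sequentially. norm (x j - xs) + \<epsilon> j < min r u"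
      using \<open>r > 0\<close> \<open>u > 0\<close> by (intro order_tendstoD) auto
    then show ?thesis
      using eventually_ge_at_top[of 1]
    proof eventually_elim
      case (elim j)
      then obtain \<xi> where \<xi>: "\<xi> \<in> goldstein_subdiff (\<epsilon> j) f (x j)" "norm \<xi> \<le> \<delta> j"
        using assms(6) by blast
      show ?case
        by (rule goldstein_subdiff_estimate[OF _ _ _ \<open>L \<ge> 0\<close> elim(1) \<xi>])
          (use growth bound c in auto)
    qed
  qed
  have from_some: "\<exists>N\<ge>1. \<forall>j>N. P j" if ev: "\<forall>\<^sub>F j in sequentially. P j" for P :: "nat \<Rightarrow> bool"
  proof -
    obtain N where "\<forall>j\<ge>N. P j"
      using ev unfolding eventually_sequentially by blast
    then show ?thesis by (intro exI[of _ "max 1 N"]) auto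
  qed
  show ?thesis
  proof (intro conjI impI)
    assume "p = 1 \<and> (\<exists>\<delta>'<\<beta>. \<delta> \<longlonglongrightarrow> \<delta>')"
    then obtain \<delta>' where "p = 1" "\<delta>' < \<beta>" "\<delta> \<longlonglongrightarrow> \<delta>'" by blast
    \<comment> \<open>Eventually \<open>\<delta> j < m < c\<close>, so the term
      \<open>\<delta> j * norm (x j - xs)\<close> can be absorbed on the left, leaving the positive
      factor \<open>c - m\<close>. The maximum with 0 makes \<open>m\<close>, and with it
      \<open>c\<close>, positive.\<close>
    obtain m where m: "max 0 \<delta>' < m" "m < \<beta>"
      using dense[of "max 0 \<delta>'" \<beta>] \<open>\<delta>' < \<beta>\<close> assms(8) by auto
    obtain c where c: "m < c" "c < \<beta>"
      using dense[OF m(2)] by blast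
    have "\<forall>\<^sub>F j in sequentially. norm (x j - xs) \<le> (c + L) / (c - m) * \<epsilon> j"
      using estimate[of c, OF _ c(2)] order_tendstoD(2)[OF \<open>\<delta> \<longlonglongrightarrow> \<delta>'\<close>, of m]
    proof (rule eventually_elim2)
      show "0 < c" "\<delta>' < m" using m c by auto
      fix j
      assume est: "c * max 0 (norm (x j - xs) - \<epsilon> j) ^ p \<le> \<delta> j * norm (x j - xs) + L * \<epsilon> j"
        and "\<delta> j < m"
      have "c * (norm (x j - xs) - \<epsilon> j) \<le> c * max 0 (norm (x j - xs) - \<epsilon> j)"
        using m c by (intro mult_left_mono) auto
      moreover have "\<delta> j * norm (x j - xs) \<le> m * norm (x j - xs)"
        using \<open>\<delta> j < m\<close> by (intro mult_right_mono) auto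
      ultimately have "(c - m) * norm (x j - xs) \<le> (c + L) * \<epsilon> j"
        using est \<open>p = 1\<close> by (simp add: algebra_simps)
      then show "norm (x j - xs) \<le> (c + L) / (c - m) * \<epsilon> j"
        using c by (simp add: field_simps)
    qed
    moreover have "(c + L) / (c - m) > 0"
      using m c \<open>L \<ge> 0\<close> by simp
    ultimately show "\<exists>M>0. \<exists>N\<ge>1. \<forall>j>N. norm (x j - xs) \<le> M * \<epsilon> j"
      using from_some by blast
  next
    assume "p \<ge> 2"
    \<comment> \<open>Any value strictly between 0 and \<beta> would do; no comparison with the
      limit of \<delta> is involved in this case.\<close>
    define c where "c = \<beta> / 2"
    have c: "0 < c" "c < \<beta>" using assms(8) by (auto simp: c_def)
    define K where "K = 2 * 2 ^ p / c"
    define M where "M = 2 + K powr (1 / real (p - 1)) + (K * L) powr (1 / p)"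
    have "\<forall>\<^sub>F j in sequentially. \<epsilon> j < 1"
      using order_tendstoD(2)[OF assms(5)] by simp
    with estimate[OF c] eventually_ge_at_top[of 1]
    have "\<forall>\<^sub>F j in sequentially. norm (x j - xs) \<le>
            M * max (\<epsilon> j powr (1 / real p)) (\<delta> j powr (1 / real (p - 1)))"
    proof eventually_elim
      case (elim j)
      then show ?case
        unfolding M_def K_def
        using order_estimate[OF elim(1) \<open>p \<ge> 2\<close> c(1) \<open>L \<ge> 0\<close>] assms(2,3)
        by simp
    qed
    moreover have "M > 0"
      by (simp add: M_def add_pos_nonneg)
    ultimately show "\<exists>M>0. \<exists>N\<ge>1. \<forall>j>N. norm (x j - xs) \<le>
        M * max (\<epsilon> j powr (1 / real p)) (\<delta> j powr (1 / real (p - 1)))"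
      using from_some by blast
  qed
qed

end
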